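(* Let $S$ be a left Ore semigroup with unit, and $G=S^{-1}S$ its group of left quotients. Any isometric inverse representation of $S$ induces a partial representation of $G$. Any injective action of $S$ on a space $X$ induces a partial action of $G$ on $X$. Any injective action of $S$ on a C*-algebra $A$ with ideal images induces a partial action of $G$ on $A$.
   Context: A left Ore semigroup is a left and right cancellative semigroup $S$ with $Sp\cap Sq\neq\emptyset$ for all $p,q\in S$; equivalently $S$ embeds in a group $G$ with $G=S^{-1}S$. An isometric inverse representation of $S$ is a representation $\pi$ of $S$ by isometries on a Hilbert space such that $\pi(S)\cup\pi(S)^*$ generates a semigroup of partial isometries (an inverse semigroup). A partial representation of $G$ on a Hilbert space $H$ is a map $T\colon G\to B(H)$ with $T_{g^{-1}}T_gT_h=T_{g^{-1}}T_{gh}$, $T_gT_hT_{h^{-1}}=T_{gh}T_{h^{-1}}$, $T_gT_1=T_g$ for all $g,h\in G$. An injective action of $S$ on a space $X$ is a family of injective maps $\alpha_s\colon X\to X$ with $\alpha_s\alpha_t=\alpha_{st}$. An injective action with ideal images of $S$ on a C*-algebra $A$ is a family of injective *-homomorphisms $\alpha_s\colon A\to A$ with $\alpha_{st}=\alpha_s\alpha_t$ and each $\alpha_s(A)$ a closed two-sided *-ideal. $\alpha_s^*$ denotes the inverse of $\alpha_s$, defined on the image of $\alpha_s$. A partial action of $G$ on a set $X$ (resp. C*-algebra $A$) is a family of bijections $\alpha_g\colon D_{g^{-1}}\to D_g$ between subsets of $X$ (resp. *-isomorphisms between closed two-sided *-ideals of $A$) such that $D_1$ is the whole of $X$ (resp.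 $A$) and $\alpha_1=\mathrm{id}$; $\alpha_g(D_{g^{-1}}\cap D_h)=D_g\cap D_{gh}$; $\alpha_g\alpha_h(x)=\alpha_{gh}(x)$ for $x\in D_{h^{-1}}\cap D_{h^{-1}g^{-1}}$. "Induces" means: for $g=s^{-1}p$ with $s,p\in S$, the partial representation is $T_g=\pi(s)^*\pi(p)$, and the partial action is $g\mapsto\alpha_s^*\alpha_p$ (composition of partial maps on the largest possible domain). *)

theory Defs
  imports Complex_Main "HOL-Algebra.Coset" "HOL-Algebra.Divisibility"
begin

section \<open>Left Ore semigroups and groups of left quotients\<close>

(* monoid_cancel is two-sided cancellation; carrier S #> p is the left ideal Sp. *)
locale left_ore_monoid = monoid_cancel S for S (structure) +
  assumes left_ore:
    "p \<in> carrier S \<Longrightarrow> q \<in> carrier S \<Longrightarrow> (carrier S #> p) \<inter> (carrier S #> q) \<noteq> {}"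

(* (G, \<iota>) is any realisation of the group of left quotients of S; it is unique up to
   isomorphism. \<iota> maps the unit to the unit because its image is idempotent. *)
locale left_quotient_group = S: left_ore_monoid S + G: group G
  for S (structure) and G (structure) +
  fixes \<iota>
  assumes embedding_hom: "\<iota> \<in> hom S G"
    and embedding_inj: "inj_on \<iota> (carrier S)"
    and left_quotients:
      "carrier G = {inv\<^bsub>G\<^esub> (\<iota> s) \<otimes>\<^bsub>G\<^esub> \<iota> p | s p. s \<in> carrier S \<and> p \<in> carrier S}"

section \<open>Complex Hilbert spaces and C*-algebras\<close>

class complex_vector = real_vector +
  fixes scaleC :: "complex \<Rightarrow> 'a \<Rightarrow> 'a"  (infixr \<open>*\<^sub>C\<close> 75)
  assumes scaleC_add_right: "c *\<^sub>C (x + y) = c *\<^sub>C x + c *\<^sub>C y"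
    and scaleC_add_left: "(c + d) *\<^sub>C x = c *\<^sub>C x + d *\<^sub>C x"
    and scaleC_scaleC: "c *\<^sub>C (d *\<^sub>C x) = (c * d) *\<^sub>C x"
    and scaleC_one: "1 *\<^sub>C x = x"
    and scaleR_scaleC: "r *\<^sub>R x = complex_of_real r *\<^sub>C x"

(* The inner product is conjugate linear in the first argument. Axiom cinner_self says that
   it is positive definite and that the norm (complete, by banach) is the induced one. *)
class chilbert_space = complex_vector + banach +
  fixes cinner :: "'a \<Rightarrow> 'a \<Rightarrow> complex"
  assumes cinner_commute: "cinner x y = cnj (cinner y x)"
    and cinner_add_right: "cinner x (y + z) = cinner x y + cinner x z"
    and cinner_scaleC_right: "cinner x (c *\<^sub>C y) = c * cinner x y"
    and cinner_self: "cinner x x = complex_of_real ((norm x)\<^sup>2)"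

(* Not necessarily unital. *)
class cstar_algebra = complex_vector + real_normed_algebra + banach +
  fixes star :: "'a \<Rightarrow> 'a"
  assumes norm_scaleC: "norm (c *\<^sub>C x) = cmod c * norm x"
    and mult_scaleC_left: "(c *\<^sub>C x) * y = c *\<^sub>C (x * y)"
    and mult_scaleC_right: "x * (c *\<^sub>C y) = c *\<^sub>C (x * y)"
    and star_star: "star (star x) = x"
    and star_add: "star (x + y) = star x + star y"
    and star_scaleC: "star (c *\<^sub>C x) = cnj c *\<^sub>C star x"
    and star_mult: "star (x * y) = star y * star x"
    and cstar_identity: "norm (star x * x) = (norm x)\<^sup>2"

section \<open>Representations on a Hilbert space\<close>

definition bounded_clinear :: "('h::chilbert_space \<Rightarrow> 'h) \<Rightarrow> bool" where
  "bounded_clinear T \<longleftrightarrow> bounded_linear T \<and> (\<forall>c x. T (c *\<^sub>C x) = c *\<^sub>C T x)"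

(* Only meaningful for bounded operators, where existence is the Riesz theorem. *)
definition cadjoint :: "('h::chilbert_space \<Rightarrow> 'h) \<Rightarrow> 'h \<Rightarrow> 'h" where
  "cadjoint T = (THE T'. \<forall>x y. cinner (T' x) y = cinner x (T y))"

definition hilbert_isometry :: "('h::chilbert_space \<Rightarrow> 'h) \<Rightarrow> bool" where
  "hilbert_isometry V \<longleftrightarrow> bounded_clinear V \<and> (\<forall>x. norm (V x) = norm x)"

(* Isometric on the orthogonal complement of the kernel. *)
definition partial_isometry :: "('h::chilbert_space \<Rightarrow> 'h) \<Rightarrow> bool" where
  "partial_isometry T \<longleftrightarrow> bounded_clinear T \<and>
     (\<forall>x. (\<forall>y. T y = 0 \<longrightarrow> cinner y x = 0) \<longrightarrow> norm (T x) = norm x)"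

inductive_set generated_semigroup :: "('h \<Rightarrow> 'h) set \<Rightarrow> ('h \<Rightarrow> 'h) set"
  for M where
    generator: "T \<in> M \<Longrightarrow> T \<in> generated_semigroup M"
  | product: "T \<in> generated_semigroup M \<Longrightarrow> U \<in> generated_semigroup M
      \<Longrightarrow> T \<circ> U \<in> generated_semigroup M"

(* The unit acts as the identity automatically, since an idempotent isometry is the identity.
   Being closed under adjoints, a generated semigroup of partial isometries is automatically
   an inverse semigroup. *)
locale isometric_inverse_representation =
  fixes S (structure) and \<pi> :: "'s \<Rightarrow> 'h::chilbert_space \<Rightarrow> 'h"
  assumes isometries: "s \<in> carrier S \<Longrightarrow> hilbert_isometry (\<pi> s)"
    and multiplicative: "s \<in> carrier S \<Longrightarrow> t \<in> carrier S \<Longrightarrow> \<pi> (s \<otimes> t) = \<pi> s \<circ> \<pi> t"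
    and partial_isometries:
      "T \<in> generated_semigroup (\<pi> ` carrier S \<union> (\<lambda>s. cadjoint (\<pi> s)) ` carrier S)
        \<Longrightarrow> partial_isometry T"

locale partial_representation = group G for G (structure) +
  fixes T :: "'g \<Rightarrow> 'h::chilbert_space \<Rightarrow> 'h"
  assumes bounded: "g \<in> carrier G \<Longrightarrow> bounded_clinear (T g)"
    and left: "g \<in> carrier G \<Longrightarrow> h \<in> carrier G
      \<Longrightarrow> T (inv g) \<circ> T g \<circ> T h = T (inv g) \<circ> T (g \<otimes> h)"
    and right: "g \<in> carrier G \<Longrightarrow> h \<in> carrier G
      \<Longrightarrow> T g \<circ> T h \<circ> T (inv h) = T (g \<otimes> h) \<circ> T (inv h)"
    and unit: "g \<in> carrier G \<Longrightarrow> T g \<circ> T \<one> = T g"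

section \<open>Injective actions\<close>

locale injective_action =
  fixes S (structure) and X :: "'x set" and \<alpha> :: "'s \<Rightarrow> 'x \<Rightarrow> 'x"
  assumes maps_to: "s \<in> carrier S \<Longrightarrow> \<alpha> s \<in> X \<rightarrow> X"
    and injective: "s \<in> carrier S \<Longrightarrow> inj_on (\<alpha> s) X"
    and action: "s \<in> carrier S \<Longrightarrow> t \<in> carrier S \<Longrightarrow> x \<in> X \<Longrightarrow> \<alpha> s (\<alpha> t x) = \<alpha> (s \<otimes> t) x"

definition closed_star_ideal :: "'a::cstar_algebra set \<Rightarrow> bool" where
  "closed_star_ideal I \<longleftrightarrow> closed I \<and> 0 \<in> I \<and> (\<forall>x\<in>I. \<forall>y\<in>I. x + y \<in> I) \<and>
     (\<forall>c. \<forall>x\<in>I. c *\<^sub>C x \<in> I) \<and> (\<forall>a. \<forall>x\<in>I. a * x \<in> I \<and> x * a \<in> I) \<and> (\<forall>x\<in>I. star x \<in> I)"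

(* Used with I a closed star ideal, in particular the whole algebra. *)
definition star_hom_on :: "'a::cstar_algebra set \<Rightarrow> ('a \<Rightarrow> 'b::cstar_algebra) \<Rightarrow> bool" where
  "star_hom_on I f \<longleftrightarrow>
     (\<forall>x\<in>I. \<forall>y\<in>I. f (x + y) = f x + f y \<and> f (x * y) = f x * f y) \<and>
     (\<forall>c. \<forall>x\<in>I. f (c *\<^sub>C x) = c *\<^sub>C f x) \<and> (\<forall>x\<in>I. f (star x) = star (f x))"

locale injective_action_ideal_images = injective_action S UNIV \<alpha>
  for S (structure) and \<alpha> :: "'s \<Rightarrow> 'a::cstar_algebra \<Rightarrow> 'a" +
  assumes star_hom: "s \<in> carrier S \<Longrightarrow> star_hom_on UNIV (\<alpha> s)"
    and ideal_image: "s \<in> carrier S \<Longrightarrow> closed_star_ideal (range (\<alpha> s))"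

section \<open>Partial actions\<close>

(* The map with index g is encoded as an option-valued partial map whose domain is exactly
   D (inv g), so that equality of partial maps includes equality of domains. *)
locale partial_action = group G for G (structure) +
  fixes X :: "'x set" and D :: "'g \<Rightarrow> 'x set" and \<theta> :: "'g \<Rightarrow> 'x \<rightharpoonup> 'x"
  assumes subset: "g \<in> carrier G \<Longrightarrow> D g \<subseteq> X"
    and domain: "g \<in> carrier G \<Longrightarrow> dom (\<theta> g) = D (inv g)"
    and bijective: "g \<in> carrier G \<Longrightarrow> bij_betw (the \<circ> \<theta> g) (D (inv g)) (D g)"
    and unit_domain: "D \<one> = X"
    and unit_identity: "x \<in> X \<Longrightarrow> \<theta> \<one> x = Some x"
    and image_domain: "g \<in> carrier G \<Longrightarrow> h \<in> carrier G
      \<Longrightarrow> (the \<circ> \<theta> g) ` (D (inv g) \<inter> D h) = D g \<inter> D (g \<otimes> h)"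
    and composition: "g \<in> carrier G \<Longrightarrow> h \<in> carrier G
      \<Longrightarrow> x \<in> D (inv h) \<inter> D (inv h \<otimes> inv g) \<Longrightarrow> (\<theta> g \<circ>\<^sub>m \<theta> h) x = \<theta> (g \<otimes> h) x"

locale cstar_partial_action = partial_action G UNIV D \<theta>
  for G (structure) and D :: "'g \<Rightarrow> 'a::cstar_algebra set" and \<theta> :: "'g \<Rightarrow> 'a \<rightharpoonup> 'a" +
  assumes ideal_domain: "g \<in> carrier G \<Longrightarrow> closed_star_ideal (D g)"
    and star_hom: "g \<in> carrier G \<Longrightarrow> star_hom_on (D (inv g)) (the \<circ> \<theta> g)"

definition as_partial :: "'x set \<Rightarrow> ('x \<Rightarrow> 'x) \<Rightarrow> 'x \<rightharpoonup> 'x" where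
  "as_partial X f = (Some \<circ> f) |` X"

definition partial_inverse :: "'x set \<Rightarrow> ('x \<Rightarrow> 'x) \<Rightarrow> 'x \<rightharpoonup> 'x" where
  "partial_inverse X f = (Some \<circ> the_inv_into X f) |` (f ` X)"

end

theory Submission
  imports Defs "HOL-Analysis.Elementary_Normed_Spaces"
begin

text \<open>
  If $ap = bt$ with $a, b \in S$, then $(s^{-1}p)(t^{-1}q) = (as)^{-1}(bq)$. For isometries $V_s = \pi(s)$
  with range projections $E_s = V_s V_s^*$ this gives
  $V_p V_t^* = E_p V_a^* V_b = V_a^* V_b E_t$, and the partial representation identities
  amount to the commutation of range projections, which holds because their products
  are partial isometries. For an action, $\theta_g x = y$ means $\alpha_p x = \alpha_s y$ for
  $g = s^{-1}p$; this relation is compatible with inversion and multiplication in $G$.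
  For C*-algebras the domains are preimages of closed ideals under *-homomorphisms, so they
  are closed because *-homomorphisms are contractive. This is shown without spectral theory:
  if $h$ is self-adjoint with $\|h\| < 1$, then $h^2 + (1-c)^2 = 1$ for some self-adjoint
  $c$ commuting with $h$, so the image of $h$ is the real part of a unitary.
\<close>

section \<open>Calculus of left quotients\<close>

context left_quotient_group
begin

lemma embedding_closed: "s \<in> carrier S \<Longrightarrow> \<iota> s \<in> carrier G"
  using embedding_hom by (auto simp: hom_def)

lemma embedding_mult:
  "s \<in> carrier S \<Longrightarrow> t \<in> carrier S \<Longrightarrow> \<iota> (s \<otimes> t) = \<iota> s \<otimes>\<^bsub>G\<^esub> \<iota> t"
  using embedding_hom by (auto simp: hom_def)

definition quot :: "'a \<Rightarrow> 'a \<Rightarrow> 'c" where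
  "quot s p = inv\<^bsub>G\<^esub> (\<iota> s) \<otimes>\<^bsub>G\<^esub> \<iota> p"

lemma quotE:
  assumes "g \<in> carrier G"
  obtains s p where "s \<in> carrier S" "p \<in> carrier S" "g = quot s p"
  using assms left_quotients by (auto simp: quot_def)

lemma quot_inv: "s \<in> carrier S \<Longrightarrow> p \<in> carrier S \<Longrightarrow> inv\<^bsub>G\<^esub> (quot s p) = quot p s"
  by (simp add: quot_def embedding_closed G.inv_mult_group)

lemma quot_self: "s \<in> carrier S \<Longrightarrow> quot s s = \<one>\<^bsub>G\<^esub>"
  by (simp add: quot_def embedding_closed)

lemma common_left_multiple:
  assumes "p \<in> carrier S" "q \<in> carrier S"
  obtains a b where "a \<in> carrier S" "b \<in> carrier S" "a \<otimes> p = b \<otimes> q"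
  using S.left_ore[OF assms] by (auto simp: r_coset_def)

text \<open>The Ore condition supplies \<open>a\<close> and \<open>b\<close> that make the
  denominators agree. Left multiplication by the image of
  \<open>a \<otimes> s = b \<otimes> t\<close> clears them on both sides, and injectivity of
  \<open>\<iota>\<close> compares the numerators.\<close>

lemma quot_eqE:
  assumes "s \<in> carrier S" "p \<in> carrier S" "t \<in> carrier S" "q \<in> carrier S"
    and eq: "quot s p = quot t q"
  obtains a b where "a \<in> carrier S" "b \<in> carrier S" "a \<otimes> s = b \<otimes> t" "a \<otimes> p = b \<otimes> q"
proof -
  obtain a b where ab: "a \<in> carrier S" "b \<in> carrier S" "a \<otimes> s = b \<otimes> t"
    using common_left_multiple assms by metis
  note cl = ab(1,2) assms(1-4) embedding_closed
  have "\<iota> (u \<otimes> v) \<otimes>\<^bsub>G\<^esub> quot v w = \<iota> (u \<otimes> w)"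
    if "u \<in> carrier S" "v \<in> carrier S" "w \<in> carrier S" for u v w
    using that by (simp add: quot_def embedding_closed embedding_mult G.m_assoc)
      (simp flip: G.m_assoc add: embedding_closed)
  then have "\<iota> (a \<otimes> p) = \<iota> (b \<otimes> q)"
    using cl eq ab(3) by metis
  then have "a \<otimes> p = b \<otimes> q"
    using embedding_inj cl by (auto dest: inj_onD)
  with ab that show ?thesis by blast
qed

lemma quot_cancel_left:
  assumes "a \<in> carrier S" "s \<in> carrier S" "p \<in> carrier S"
  shows "quot (a \<otimes> s) (a \<otimes> p) = quot s p"
proof -
  have "inv\<^bsub>G\<^esub> (\<iota> a) \<otimes>\<^bsub>G\<^esub> (\<iota> a \<otimes>\<^bsub>G\<^esub> \<iota> p) = \<iota> p"
    using assms by (simp flip: G.m_assoc add: embedding_closed)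
  then show ?thesis
    using assms by (simp add: quot_def embedding_closed embedding_mult G.inv_mult_group G.m_assoc)
qed

text \<open>Expansion by \<open>a\<close> and \<open>b\<close> makes the numerator of the first
  fraction equal to the denominator of the second, and these cancel in the product.\<close>

lemma quot_mult:
  assumes "s \<in> carrier S" "p \<in> carrier S" "t \<in> carrier S" "q \<in> carrier S"
    and "a \<in> carrier S" "b \<in> carrier S" and eq: "a \<otimes> p = b \<otimes> t"
  shows "quot s p \<otimes>\<^bsub>G\<^esub> quot t q = quot (a \<otimes> s) (b \<otimes> q)"
proof -
  have mid: "quot u v \<otimes>\<^bsub>G\<^esub> quot v w = quot u w"
    if "u \<in> carrier S" "v \<in> carrier S" "w \<in> carrier S" for u v w
  proof -
    have "\<iota> v \<otimes>\<^bsub>G\<^esub> (inv\<^bsub>G\<^esub> (\<iota> v) \<otimes>\<^bsub>G\<^esub> \<iota> w) = \<iota> w"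
      using that by (simp flip: G.m_assoc add: embedding_closed)
    then show ?thesis
      using that by (simp add: quot_def embedding_closed G.m_assoc)
  qed
  have "quot s p \<otimes>\<^bsub>G\<^esub> quot t q
      = quot (a \<otimes> s) (a \<otimes> p) \<otimes>\<^bsub>G\<^esub> quot (b \<otimes> t) (b \<otimes> q)"
    using quot_cancel_left[OF assms(5,1,2)] quot_cancel_left[OF assms(6,3,4)] by simp
  also have "\<dots> = quot (a \<otimes> s) (b \<otimes> q)"
    unfolding eq using assms(1-6) by (simp add: mid)
  finally show ?thesis .
qed

text \<open>By \<open>quot_eqE\<close>, two fractions for the same element have a common expansion.
  Well-definedness on the group thus reduces to invariance under expansion by one left
  factor.\<close>

lemma factor_through_quot:
  assumes inv: "\<And>a s p. a \<in> carrier S \<Longrightarrow> s \<in> carrier S \<Longrightarrow> p \<in> carrier S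
      \<Longrightarrow> f (a \<otimes> s) (a \<otimes> p) = f s p"
  shows "\<exists>F. \<forall>s\<in>carrier S. \<forall>p\<in>carrier S. F (quot s p) = f s p"
proof -
  define F where "F g = (SOME y. \<exists>s\<in>carrier S. \<exists>p\<in>carrier S. g = quot s p \<and> y = f s p)" for g
  have "F (quot s p) = f s p" if sp: "s \<in> carrier S" "p \<in> carrier S" for s p
    unfolding F_def
  proof (rule some_equality)
    fix y assume "\<exists>s'\<in>carrier S. \<exists>p'\<in>carrier S. quot s p = quot s' p' \<and> y = f s' p'"
    then obtain t q where tq: "t \<in> carrier S" "q \<in> carrier S" "quot s p = quot t q" "y = f t q"
      by blast
    then obtain a b where "a \<in> carrier S" "b \<in> carrier S" "a \<otimes> s = b \<otimes> t" "a \<otimes> p = b \<otimes> q"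
      using quot_eqE sp by metis
    then show "y = f s p"
      using inv sp tq by metis
  qed (use sp in blast)
  then show ?thesis by blast
qed

end

section \<open>Injective actions\<close>

text \<open>Replaces composition on the largest domain by a relation symmetric in the two maps, so
  that questions about domains and inverses become equations in \<open>X\<close>.\<close>

lemma partial_inverse_comp_eq_Some:
  assumes "inj_on f X"
  shows "(partial_inverse X f \<circ>\<^sub>m as_partial X g) x = Some y \<longleftrightarrow> x \<in> X \<and> y \<in> X \<and> g x = f y"
proof (cases "x \<in> X")
  case True
  have "(g x \<in> f ` X \<and> the_inv_into X f (g x) = y) \<longleftrightarrow> y \<in> X \<and> g x = f y"
    using the_inv_into_f_f[OF assms] by auto
  then show ?thesis
    using True by (auto simp: partial_inverse_def as_partial_def map_comp_def restrict_map_def)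
next
  case False
  then show ?thesis by (simp add: as_partial_def map_comp_def restrict_map_def)
qed

section \<open>The partial action induced on a space\<close>

locale quotient_action = left_quotient_group S G \<iota> + injective_action S X \<alpha>
  for S (structure) and G (structure) and \<iota> and X :: "'x set" and \<alpha>
begin

text \<open>Injectivity of \<open>\<alpha> a\<close> cancels \<open>a\<close> from the relation
  \<open>\<alpha> p x = \<alpha> s y\<close>, so expanding the fraction changes neither values nor
  domain.\<close>

lemma quotient_map:
  "\<exists>\<theta>. \<forall>s\<in>carrier S. \<forall>p\<in>carrier S.
      \<theta> (quot s p) = partial_inverse X (\<alpha> s) \<circ>\<^sub>m as_partial X (\<alpha> p)"
proof (rule factor_through_quot[where
      f = "\<lambda>s p. partial_inverse X (\<alpha> s) \<circ>\<^sub>m as_partial X (\<alpha> p)"])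
  fix a s p assume as: "a \<in> carrier S" "s \<in> carrier S" "p \<in> carrier S"
  have eq_iff: "\<alpha> (a \<otimes> p) x = \<alpha> (a \<otimes> s) y \<longleftrightarrow> \<alpha> p x = \<alpha> s y" if "x \<in> X" "y \<in> X" for x y
  proof -
    have "\<alpha> p x \<in> X" "\<alpha> s y \<in> X"
      using that as maps_to by blast+
    then have "\<alpha> a (\<alpha> p x) = \<alpha> a (\<alpha> s y) \<longleftrightarrow> \<alpha> p x = \<alpha> s y"
      using injective as by (auto dest: inj_onD)
    then show ?thesis
      using that as by (simp add: action)
  qed
  have "(partial_inverse X (\<alpha> (a \<otimes> s)) \<circ>\<^sub>m as_partial X (\<alpha> (a \<otimes> p))) x = Some y \<longleftrightarrow>
      (partial_inverse X (\<alpha> s) \<circ>\<^sub>m as_partial X (\<alpha> p)) x = Some y" for x y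
    using as by (auto simp: partial_inverse_comp_eq_Some injective eq_iff)
  then show "partial_inverse X (\<alpha> (a \<otimes> s)) \<circ>\<^sub>m as_partial X (\<alpha> (a \<otimes> p))
      = partial_inverse X (\<alpha> s) \<circ>\<^sub>m as_partial X (\<alpha> p)"
    by (intro ext) (metis option.exhaust)
qed

end

locale induced_map = quotient_action S G \<iota> X \<alpha>
  for S (structure) and G (structure) and \<iota> and X :: "'x set" and \<alpha> +
  fixes \<theta>
  assumes quot_map: "s \<in> carrier S \<Longrightarrow> p \<in> carrier S \<Longrightarrow>
      \<theta> (quot s p) = partial_inverse X (\<alpha> s) \<circ>\<^sub>m as_partial X (\<alpha> p)"
begin

text \<open>This is the range of \<open>\<theta> g\<close>, as \<open>range_iff\<close> confirms;
  writing it as the domain of the inverse makes the domain axiom immediate.\<close>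

definition D where "D g = dom (\<theta> (inv\<^bsub>G\<^esub> g))"

lemma quot_map_eq_Some:
  "s \<in> carrier S \<Longrightarrow> p \<in> carrier S \<Longrightarrow>
    \<theta> (quot s p) x = Some y \<longleftrightarrow> x \<in> X \<and> y \<in> X \<and> \<alpha> p x = \<alpha> s y"
  using injective by (simp add: quot_map partial_inverse_comp_eq_Some)

text \<open>Presents the domain as a preimage of an image, the form in which it is later recognised
  as a closed ideal.\<close>

lemma quot_domain:
  "s \<in> carrier S \<Longrightarrow> p \<in> carrier S \<Longrightarrow> D (quot s p) = {y \<in> X. \<alpha> s y \<in> \<alpha> p ` X}"
  by (auto simp: D_def quot_inv quot_map_eq_Some dom_def)

lemma map_closed: "g \<in> carrier G \<Longrightarrow> \<theta> g x = Some y \<Longrightarrow> x \<in> X \<and> y \<in> X"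
  by (elim quotE) (simp add: quot_map_eq_Some)

lemma map_inv: "g \<in> carrier G \<Longrightarrow> \<theta> (inv\<^bsub>G\<^esub> g) y = Some x \<longleftrightarrow> \<theta> g x = Some y"
  by (elim quotE) (auto simp: quot_inv quot_map_eq_Some)

lemma map_one: "\<theta> \<one>\<^bsub>G\<^esub> x = Some y \<longleftrightarrow> x \<in> X \<and> x = y"
  using quot_map_eq_Some[of \<one> \<one> x y] injective[of \<one>]
  by (auto simp: quot_self inj_on_def)

text \<open>Apply \<open>b\<close> to \<open>\<alpha> q x = \<alpha> t y\<close> and
  \<open>a\<close> to \<open>\<alpha> p y = \<alpha> s z\<close>. Since
  \<open>a \<otimes> p = b \<otimes> t\<close>, the two equations chain into the relation for the
  fraction of \<open>quot_mult\<close>.\<close>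

lemma map_mult:
  assumes "g \<in> carrier G" "h \<in> carrier G" and xy: "\<theta> h x = Some y" and yz: "\<theta> g y = Some z"
  shows "\<theta> (g \<otimes>\<^bsub>G\<^esub> h) x = Some z"
proof -
  obtain s p where sp: "s \<in> carrier S" "p \<in> carrier S" "g = quot s p"
    using assms quotE by metis
  obtain t q where tq: "t \<in> carrier S" "q \<in> carrier S" "h = quot t q"
    using assms quotE by metis
  obtain a b where ab: "a \<in> carrier S" "b \<in> carrier S" "a \<otimes> p = b \<otimes> t"
    using common_left_multiple sp tq by metis
  have X: "x \<in> X" "y \<in> X" "z \<in> X" "\<alpha> q x = \<alpha> t y" "\<alpha> p y = \<alpha> s z"
    using xy yz sp tq by (auto simp: quot_map_eq_Some)
  have "\<alpha> (b \<otimes> q) x = \<alpha> (b \<otimes> t) y"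
    using X ab tq by (simp flip: action)
  also have "\<dots> = \<alpha> (a \<otimes> s) z"
    using X ab sp by (simp flip: action ab(3))
  finally show ?thesis
    using X ab sp tq by (simp add: quot_mult quot_map_eq_Some)
qed

lemma range_iff: "g \<in> carrier G \<Longrightarrow> y \<in> D g \<longleftrightarrow> (\<exists>x. \<theta> g x = Some y)"
  by (auto simp: D_def dom_def map_inv)

lemma domain_inv_iff: "g \<in> carrier G \<Longrightarrow> x \<in> D (inv\<^bsub>G\<^esub> g) \<longleftrightarrow> (\<exists>y. \<theta> g x = Some y)"
  by (auto simp: D_def dom_def)

text \<open>This is \<open>map_mult\<close> for g^-1 and gh. It gives the harder inclusion of the
  image axiom: a point of \<open>D g\<close> and \<open>D (gh)\<close> comes from a point of
  \<open>D h\<close>.\<close>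

lemma map_left_divide:
  assumes "g \<in> carrier G" "h \<in> carrier G"
    and "\<theta> g x = Some y" "\<theta> (g \<otimes>\<^bsub>G\<^esub> h) w = Some y"
  shows "\<theta> h w = Some x"
proof -
  have "inv\<^bsub>G\<^esub> g \<otimes>\<^bsub>G\<^esub> (g \<otimes>\<^bsub>G\<^esub> h) = h"
    using assms by (simp flip: G.m_assoc)
  then show ?thesis
    using map_mult[of "inv\<^bsub>G\<^esub> g" "g \<otimes>\<^bsub>G\<^esub> h" w y x] assms by (simp add: map_inv)
qed

text \<open>This is \<open>map_mult\<close> for gh and h^-1. It shows that the composite is defined
  wherever the composition axiom demands it.\<close>

lemma map_right_divide:
  assumes "g \<in> carrier G" "h \<in> carrier G"
    and "\<theta> h x = Some y" "\<theta> (g \<otimes>\<^bsub>G\<^esub> h) x = Some z"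
  shows "\<theta> g y = Some z"
proof -
  have "g \<otimes>\<^bsub>G\<^esub> h \<otimes>\<^bsub>G\<^esub> inv\<^bsub>G\<^esub> h = g"
    using assms by (simp add: G.m_assoc)
  then show ?thesis
    using map_mult[of "g \<otimes>\<^bsub>G\<^esub> h" "inv\<^bsub>G\<^esub> h" y x z] assms by (simp add: map_inv)
qed

lemma partial_action: "partial_action G X D \<theta>"
proof unfold_locales
  fix g assume g: "g \<in> carrier G"
  show "D g \<subseteq> X"
    using g map_closed by (auto simp: range_iff)
  show "dom (\<theta> g) = D (inv\<^bsub>G\<^esub> g)"
    using g by (simp add: D_def)
  show "bij_betw (the \<circ> \<theta> g) (D (inv\<^bsub>G\<^esub> g)) (D g)"
    unfolding bij_betw_def
  proof
    show "inj_on (the \<circ> \<theta> g) (D (inv\<^bsub>G\<^esub> g))"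
      by (rule inj_onI) (metis comp_apply domain_inv_iff g map_inv option.sel)
    show "(the \<circ> \<theta> g) ` D (inv\<^bsub>G\<^esub> g) = D g"
    proof (intro equalityI subsetI)
      fix y assume "y \<in> D g"
      then obtain x where "\<theta> g x = Some y" using g by (auto simp: range_iff)
      then show "y \<in> (the \<circ> \<theta> g) ` D (inv\<^bsub>G\<^esub> g)"
        using g by (intro image_eqI[of _ _ x]) (auto simp: domain_inv_iff)
    qed (use g range_iff domain_inv_iff in force)
  qed
next
  show "D \<one>\<^bsub>G\<^esub> = X"
    by (auto simp: range_iff map_one)
  show "\<theta> \<one>\<^bsub>G\<^esub> x = Some x" if "x \<in> X" for x
    using that by (simp add: map_one)
next
  fix g h assume gh: "g \<in> carrier G" "h \<in> carrier G"
  show "(the \<circ> \<theta> g) ` (D (inv\<^bsub>G\<^esub> g) \<inter> D h) = D g \<inter> D (g \<otimes>\<^bsub>G\<^esub> h)"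
  proof (intro equalityI subsetI)
    fix y assume "y \<in> (the \<circ> \<theta> g) ` (D (inv\<^bsub>G\<^esub> g) \<inter> D h)"
    then obtain x w where xw: "\<theta> g x = Some y" "\<theta> h w = Some x"
      using gh by (auto simp: range_iff[of h] domain_inv_iff)
    then have "\<theta> (g \<otimes>\<^bsub>G\<^esub> h) w = Some y"
      using gh map_mult by blast
    with xw(1) show "y \<in> D g \<inter> D (g \<otimes>\<^bsub>G\<^esub> h)"
      using gh by (auto simp: range_iff)
  next
    fix y assume "y \<in> D g \<inter> D (g \<otimes>\<^bsub>G\<^esub> h)"
    then obtain x w where *: "\<theta> g x = Some y" "\<theta> (g \<otimes>\<^bsub>G\<^esub> h) w = Some y"
      using gh by (auto simp: range_iff)
    then have "\<theta> h w = Some x"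
      using gh map_left_divide by blast
    with * show "y \<in> (the \<circ> \<theta> g) ` (D (inv\<^bsub>G\<^esub> g) \<inter> D h)"
      using gh by (intro image_eqI[of _ _ x]) (auto simp: range_iff[of h] domain_inv_iff)
  qed
  fix x assume "x \<in> D (inv\<^bsub>G\<^esub> h) \<inter> D (inv\<^bsub>G\<^esub> h \<otimes>\<^bsub>G\<^esub> inv\<^bsub>G\<^esub> g)"
  then obtain y z where yz: "\<theta> h x = Some y" "\<theta> (g \<otimes>\<^bsub>G\<^esub> h) x = Some z"
    using gh by (auto simp: domain_inv_iff simp flip: G.inv_mult_group)
  then show "(\<theta> g \<circ>\<^sub>m \<theta> h) x = \<theta> (g \<otimes>\<^bsub>G\<^esub> h) x"
    using map_right_divide[OF gh yz] by simp
qed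

end

section \<open>Isometries on Hilbert spaces\<close>

lemma cinner_add_left: "cinner (x + y) z = cinner x z + cinner y z"
  by (metis cinner_add_right cinner_commute complex_cnj_add)

lemma cinner_diff_right: "cinner x (y - z) = cinner x y - cinner x z"
  using cinner_add_right[of x "y - z" z] by simp

lemma cinner_diff_left: "cinner (x - y) z = cinner x z - cinner y z"
  using cinner_add_left[of "x - y" y z] by simp

lemma cinner_zero_left: "cinner 0 x = 0"
  using cinner_diff_left[of 0 0 x] by simp

lemma Re_cinner_commute: "Re (cinner x y) = Re (cinner y x)"
  by (subst cinner_commute) simp

lemma norm_diff_squared: "(norm (x - y))\<^sup>2 = (norm x)\<^sup>2 + (norm y)\<^sup>2 - 2 * Re (cinner x y)"
proof -
  have "Re (cinner (x - y) (x - y)) = Re (cinner x x) + Re (cinner y y) - 2 * Re (cinner x y)"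
    by (simp add: cinner_diff_left cinner_diff_right Re_cinner_commute[of y x])
  then show ?thesis by (simp add: cinner_self)
qed

lemma norm_add_squared: "(norm (x + y))\<^sup>2 = (norm x)\<^sup>2 + (norm y)\<^sup>2 + 2 * Re (cinner x y)"
proof -
  have "Re (cinner (x + y) (x + y)) = Re (cinner x x) + Re (cinner y y) + 2 * Re (cinner x y)"
    by (simp add: cinner_add_left cinner_add_right Re_cinner_commute[of y x])
  then show ?thesis by (simp add: cinner_self)
qed

lemma cinner_eqI:
  assumes "\<And>z. cinner x z = cinner y z"
  shows "x = y"
proof -
  have "cinner (x - y) (x - y) = 0"
    using assms by (simp add: cinner_diff_left)
  then show ?thesis by (simp add: cinner_self)
qed

text \<open>Lets an identity between inner products be checked on real parts only, by inserting both
  \<open>y\<close> and i times \<open>y\<close>.\<close>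

lemma Re_cinner_i: "Re (cinner x (\<i> *\<^sub>C y)) = - Im (cinner x y)"
  by (simp add: cinner_scaleC_right)

lemma hilbert_isometry_linear: "hilbert_isometry V \<Longrightarrow> bounded_linear V"
  by (simp add: hilbert_isometry_def bounded_clinear_def)

lemma hilbert_isometry_scaleC: "hilbert_isometry V \<Longrightarrow> V (c *\<^sub>C x) = c *\<^sub>C V x"
  by (simp add: hilbert_isometry_def bounded_clinear_def)

lemma hilbert_isometry_norm: "hilbert_isometry V \<Longrightarrow> norm (V x) = norm x"
  by (simp add: hilbert_isometry_def)

lemma hilbert_isometry_cinner:
  assumes V: "hilbert_isometry V"
  shows "cinner (V x) (V y) = cinner x y"
proof -
  interpret bounded_linear V using V by (rule hilbert_isometry_linear)
  have re: "Re (cinner (V x) (V y)) = Re (cinner x y)" for y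
    using norm_add_squared[of "V x" "V y"] norm_add_squared[of x y] V
    by (simp add: hilbert_isometry_norm flip: add)
  show ?thesis
    using re[of y] re[of "\<i> *\<^sub>C y"] V
    by (simp add: complex_eq_iff Re_cinner_i hilbert_isometry_scaleC)
qed

text \<open>The vector $Vy$ is the orthogonal projection of $x$ to the range of $V$, obtained by
  minimising the distance; parallelogram law and completeness give the minimiser.\<close>

lemma hilbert_isometry_projection:
  fixes V :: "'h::chilbert_space \<Rightarrow> 'h"
  assumes V: "hilbert_isometry V"
  shows "\<exists>y. \<forall>z. cinner (x - V y) (V z) = 0"
proof -
  interpret bounded_linear V using V by (rule hilbert_isometry_linear)
  define f where "f z = (norm (x - V z))\<^sup>2" for z
  define d where "d = Inf (range f)"
  have bdd: "bdd_below (range f)"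
    by (rule bdd_belowI[of _ 0]) (auto simp: f_def)
  have d_le: "d \<le> f z" for z
    unfolding d_def using bdd by (rule cINF_lower) simp
  have "\<exists>z. f z < d + inverse (real (Suc n))" for n
  proof -
    have "Inf (range f) < d + inverse (real (Suc n))" by (simp add: d_def)
    then show ?thesis using cInf_lessD[of "range f"] by auto
  qed
  then obtain Z where Z: "\<And>n. f (Z n) < d + inverse (real (Suc n))" by metis
  \<comment> \<open>Parallelogram law for \<open>u\<close> and \<open>v\<close>: their midpoint is
    again of the form \<open>x - V z\<close>, so its squared norm is at least \<open>d\<close>. As
    \<open>u - v\<close> is the image of \<open>Z n - Z m\<close>, isometry yields a bound on
    \<open>Z\<close> itself.\<close>
  have close: "(norm (Z m - Z n))\<^sup>2 \<le> 2 * (f (Z m) - d) + 2 * (f (Z n) - d)" for m n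
  proof -
    define u v where "u = x - V (Z m)" and "v = x - V (Z n)"
    have "u - v = V (Z n - Z m)"
      by (simp add: u_def v_def diff)
    then have uv: "norm (u - v) = norm (Z m - Z n)"
      using V by (simp add: hilbert_isometry_norm norm_minus_commute)
    have "u + v = 2 *\<^sub>R (x - V ((1/2) *\<^sub>R (Z m + Z n)))"
      by (simp add: u_def v_def add scaleR scaleR_2 algebra_simps)
    then have "(norm (u + v))\<^sup>2 = 4 * f ((1/2) *\<^sub>R (Z m + Z n))"
      by (simp add: f_def power_mult_distrib)
    then have "4 * d \<le> (norm (u + v))\<^sup>2"
      using d_le by simp
    then have "(norm (u - v))\<^sup>2 \<le> 2 * (norm u)\<^sup>2 + 2 * (norm v)\<^sup>2 - 4 * d"
      using norm_add_squared[of u v] norm_diff_squared[of u v] by linarith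
    then show ?thesis
      by (simp add: uv) (simp add: f_def u_def v_def)
  qed
  have "Cauchy Z"
    unfolding Cauchy_iff
  proof (intro allI impI)
    fix e :: real assume e: "0 < e"
    obtain N where N: "inverse (real (Suc N)) < e\<^sup>2 / 4"
      using reals_Archimedean[of "e\<^sup>2 / 4"] e by auto
    have small: "f (Z n) - d < e\<^sup>2 / 4" if "n \<ge> N" for n
    proof -
      have "inverse (real (Suc n)) \<le> inverse (real (Suc N))"
        using that by (simp add: field_simps)
      then show ?thesis using Z[of n] N by linarith
    qed
    have "norm (Z m - Z n) < e" if "m \<ge> N" "n \<ge> N" for m n
    proof -
      have "(norm (Z m - Z n))\<^sup>2 < e\<^sup>2"
        using close[of m n] small[OF that(1)] small[OF that(2)] by (simp add: field_simps)
      then show ?thesis using e by (simp add: power2_less_imp_less)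
    qed
    then show "\<exists>M. \<forall>m\<ge>M. \<forall>n\<ge>M. norm (Z m - Z n) < e" by blast
  qed
  then obtain y where y: "Z \<longlonglongrightarrow> y"
    using Cauchy_convergent_iff convergent_def by blast
  have "(\<lambda>n. f (Z n)) \<longlonglongrightarrow> f y"
    unfolding f_def by (intro tendsto_intros tendsto y)
  moreover have "(\<lambda>n. d + inverse (real (Suc n))) \<longlonglongrightarrow> d + 0"
    by (intro tendsto_intros LIMSEQ_inverse_real_of_nat)
  ultimately have "f y \<le> d + 0"
    by (rule LIMSEQ_le) (use Z less_imp_le in blast)
  then have min: "f y \<le> f z" for z
    using d_le[of z] by simp
  define w where "w = x - V y"
  have re: "Re (cinner w (V z)) = 0" for z
  proof -
    define c N where "c = Re (cinner w (V z))" and "N = (norm z)\<^sup>2"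
    have N: "N \<ge> 0" by (simp add: N_def)
    \<comment> \<open>Moving the minimiser by \<open>r\<close> times \<open>z\<close> gives
      \<open>2 * r * c <= r^2 * N\<close>. With this \<open>r\<close> the inequality becomes
      \<open>r^2 * (N + 2) <= 0\<close>; the added 1 covers \<open>z = 0\<close>.\<close>
    define r where "r = c / (N + 1)"
    have "f (y + r *\<^sub>R z) = (norm (w - V (r *\<^sub>R z)))\<^sup>2"
      by (simp add: f_def w_def add algebra_simps)
    also have "\<dots> = (norm w)\<^sup>2 + r\<^sup>2 * N - 2 * Re (cinner w (V (r *\<^sub>R z)))"
      using V by (simp add: norm_diff_squared hilbert_isometry_norm N_def power_mult_distrib)
    also have "Re (cinner w (V (r *\<^sub>R z))) = r * c"
      by (simp add: c_def scaleR) (simp add: scaleR_scaleC cinner_scaleC_right)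
    finally have "2 * r * c \<le> r\<^sup>2 * N"
      using min[of "y + r *\<^sub>R z"] by (simp add: f_def w_def)
    moreover have "c = r * (N + 1)"
      using N by (simp add: r_def)
    ultimately have "2 * r\<^sup>2 * (N + 1) \<le> r\<^sup>2 * N"
      by (simp add: power2_eq_square algebra_simps)
    then have "r\<^sup>2 * N + 2 * r\<^sup>2 \<le> 0" by (simp add: algebra_simps)
    moreover have "r\<^sup>2 * N \<ge> 0" using N by simp
    moreover have "r\<^sup>2 \<ge> 0" by simp
    ultimately have "r\<^sup>2 = 0" by linarith
    then show ?thesis
      using \<open>c = r * (N + 1)\<close> by (simp add: c_def)
  qed
  have "cinner w (V z) = 0" for z
    using re[of z] re[of "\<i> *\<^sub>C z"] V
    by (simp add: complex_eq_iff Re_cinner_i hilbert_isometry_scaleC)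
  then show ?thesis unfolding w_def by blast
qed

lemma cadjoint_eqI:
  assumes "\<And>x y. cinner (T' x) y = cinner x (T y)"
  shows "cadjoint T = T'"
  unfolding cadjoint_def
proof (rule the_equality)
  fix U assume "\<forall>x y. cinner (U x) y = cinner x (T y)"
  then show "U = T'"
    using assms by (intro ext cinner_eqI) simp
qed (use assms in blast)

text \<open>Existence of the adjoint: if \<open>V y\<close> is the projection of \<open>x\<close> to
  the range of \<open>V\<close>, then
  \<open>cinner y z = cinner (V y) (V z) = cinner x (V z)\<close>.\<close>

lemma cinner_cadjoint:
  assumes V: "hilbert_isometry V"
  shows "cinner (cadjoint V x) y = cinner x (V y)"
proof -
  have "\<exists>y. \<forall>z. cinner y z = cinner x (V z)" for x
  proof -
    obtain y where y: "\<And>z. cinner (x - V y) (V z) = 0"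
      using hilbert_isometry_projection[OF V, of x] by metis
    then have "cinner y z = cinner x (V z)" for z
      using hilbert_isometry_cinner[OF V] by (simp add: cinner_diff_left)
    then show ?thesis by blast
  qed
  then obtain T' where "\<And>x z. cinner (T' x) z = cinner x (V z)" by metis
  then show ?thesis using cadjoint_eqI by metis
qed

lemma cinner_cadjoint_right:
  "hilbert_isometry V \<Longrightarrow> cinner y (cadjoint V x) = cinner (V y) x"
  by (metis cinner_cadjoint cinner_commute)

lemma cadjoint_isometry: "hilbert_isometry V \<Longrightarrow> cadjoint V (V x) = x"
  by (rule cinner_eqI) (simp add: cinner_cadjoint hilbert_isometry_cinner)

lemma cadjoint_comp:
  "hilbert_isometry V \<Longrightarrow> hilbert_isometry W \<Longrightarrow> cadjoint (V \<circ> W) = cadjoint W \<circ> cadjoint V"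
  by (rule cadjoint_eqI) (simp add: cinner_cadjoint)

text \<open>Since $FEx$ is orthogonal to the kernel of $EF$, the projection $E$ preserves its
  norm and hence fixes it; so $EFE = FE$, and taking adjoints $EFE = EF$.\<close>

lemma projections_commute:
  assumes E: "\<And>x y. cinner (E x) y = cinner x (E y)" "\<And>x. E (E x) = E x"
    and F: "\<And>x y. cinner (F x) y = cinner x (F y)" "\<And>x. F (F x) = F x"
    and pi: "partial_isometry (E \<circ> F)"
  shows "E (F x) = F (E x)"
proof -
  have fix_FE: "E (F (E x)) = F (E x)" for x
  proof -
    define w where "w = F (E x)"
    have "cinner z w = 0" if "E (F z) = 0" for z
      using that by (simp add: w_def cinner_zero_left flip: E(1) F(1))
    then have "norm (E (F w)) = norm w"
      using pi by (simp add: partial_isometry_def)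
    then have "norm (E w) = norm w"
      by (simp add: w_def F(2))
    \<comment> \<open>Hence the squared norm of \<open>w - E w\<close> is that of \<open>w\<close>
      minus that of \<open>E w\<close>, which is zero.\<close>
    moreover have "cinner w (E w) = cinner (E w) (E w)"
      by (simp add: E)
    ultimately have "(norm (w - E w))\<^sup>2 = 0"
      by (simp add: norm_diff_squared cinner_self)
    then show ?thesis by (simp add: w_def)
  qed
  have "cinner (E (F x)) y = cinner (F (E x)) y" for y
    using fix_FE by (metis E(1) F(1))
  then show ?thesis by (rule cinner_eqI)
qed

section \<open>The partial representation induced by isometries\<close>

locale quotient_representation = left_quotient_group S G \<iota> + isometric_inverse_representation S \<pi>
  for S (structure) and G (structure) and \<iota> and \<pi>
begin

abbreviation adj where "adj s \<equiv> cadjoint (\<pi> s)"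

lemma adj_cancel: "s \<in> carrier S \<Longrightarrow> adj s (\<pi> s x) = x"
  by (simp add: cadjoint_isometry isometries)

lemma adj_mult: "s \<in> carrier S \<Longrightarrow> t \<in> carrier S \<Longrightarrow> adj (s \<otimes> t) x = adj t (adj s x)"
  by (simp add: multiplicative cadjoint_comp isometries)

text \<open>The product of the two range projections is a word in the generators, hence a partial
  isometry, and \<open>projections_commute\<close> applies.\<close>

lemma range_projections_commute:
  assumes "s \<in> carrier S" "p \<in> carrier S"
  shows "\<pi> s (adj s (\<pi> p (adj p x))) = \<pi> p (adj p (\<pi> s (adj s x)))"
proof -
  let ?M = "\<pi> ` carrier S \<union> (\<lambda>s. adj s) ` carrier S"
  have "(\<pi> s \<circ> adj s) \<circ> (\<pi> p \<circ> adj p) \<in> generated_semigroup ?M"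
    using assms by (intro generated_semigroup.intros) auto
  then have "partial_isometry ((\<pi> s \<circ> adj s) \<circ> (\<pi> p \<circ> adj p))"
    by (rule partial_isometries)
  moreover have "cinner (\<pi> t (adj t x)) y = cinner x (\<pi> t (adj t y))"
    if "t \<in> carrier S" for t x y
    using that by (metis cinner_cadjoint cinner_cadjoint_right isometries)
  ultimately have "(\<pi> s \<circ> adj s) ((\<pi> p \<circ> adj p) x) = (\<pi> p \<circ> adj p) ((\<pi> s \<circ> adj s) x)"
    using assms projections_commute[of "\<pi> s \<circ> adj s" "\<pi> p \<circ> adj p" x]
    by (simp add: adj_cancel)
  then show ?thesis by simp
qed

lemma quotient_operators:
  "\<exists>T. \<forall>s\<in>carrier S. \<forall>p\<in>carrier S. T (quot s p) = adj s \<circ> \<pi> p"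
proof (rule factor_through_quot[where f = "\<lambda>s p. adj s \<circ> \<pi> p"])
  fix a s p assume as: "a \<in> carrier S" "s \<in> carrier S" "p \<in> carrier S"
  have "adj (a \<otimes> s) (\<pi> (a \<otimes> p) x) = adj s (\<pi> p x)" for x
    unfolding adj_mult[OF as(1,2)] using as by (simp add: adj_cancel multiplicative)
  then show "adj (a \<otimes> s) \<circ> \<pi> (a \<otimes> p) = adj s \<circ> \<pi> p"
    by (simp add: fun_eq_iff)
qed

lemma partial_representation:
  assumes T: "\<And>s p. s \<in> carrier S \<Longrightarrow> p \<in> carrier S \<Longrightarrow> T (quot s p) = adj s \<circ> \<pi> p"
  shows "partial_representation G T"
proof unfold_locales
  let ?M = "\<pi> ` carrier S \<union> (\<lambda>s. adj s) ` carrier S"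
  fix g assume "g \<in> carrier G"
  then obtain s p where sp: "s \<in> carrier S" "p \<in> carrier S" "g = quot s p"
    using quotE by metis
  \<comment> \<open>Elements of the generated semigroup are partial isometries, which include
    boundedness and complex linearity by definition.\<close>
  have "adj s \<circ> \<pi> p \<in> generated_semigroup ?M"
    using sp by (intro generated_semigroup.intros) auto
  then show "bounded_clinear (T g)"
    using partial_isometries sp by (simp add: T partial_isometry_def)
  have "T \<one>\<^bsub>G\<^esub> = id"
    using T[of \<one> \<one>] by (simp add: quot_self fun_eq_iff adj_cancel)
  then show "T g \<circ> T \<one>\<^bsub>G\<^esub> = T g" by simp
next
  fix g h assume "g \<in> carrier G" "h \<in> carrier G"
  then obtain s p t q where sp: "s \<in> carrier S" "p \<in> carrier S" "g = quot s p"
    and tq: "t \<in> carrier S" "q \<in> carrier S" "h = quot t q"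
    using quotE by metis
  obtain a b where ab: "a \<in> carrier S" "b \<in> carrier S" "a \<otimes> p = b \<otimes> t"
    using common_left_multiple sp tq by metis
  have "\<pi> a (\<pi> p x) = \<pi> b (\<pi> t x)" for x
    using ab sp tq multiplicative by (metis comp_apply)
  \<comment> \<open>Cancelling \<open>\<pi> a\<close> rewrites \<open>\<pi> p\<close> as a word that
    acts first by \<open>\<pi> t\<close>; dually, \<open>adj_t\<close> rewrites \<open>adj t\<close>
    as a word that acts last by \<open>adj p\<close>. Either rewriting creates a range projection in
    the product of \<open>T g\<close> and \<open>T h\<close>.\<close>
  then have \<pi>_p: "\<pi> p x = adj a (\<pi> b (\<pi> t x))" for x
    using ab adj_cancel by metis
  have "adj p (adj a x) = adj t (adj b x)" for x
    using ab sp tq adj_mult by metis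
  then have adj_t: "adj t x = adj p (adj a (\<pi> b x))" for x
    using ab adj_cancel by metis
  have gh: "T (g \<otimes>\<^bsub>G\<^esub> h) x = adj s (adj a (\<pi> b (\<pi> q x)))" for x
  proof -
    have "T (g \<otimes>\<^bsub>G\<^esub> h) = adj (a \<otimes> s) \<circ> \<pi> (b \<otimes> q)"
      using sp tq ab by (simp add: quot_mult T)
    then show ?thesis
      by (simp only: comp_apply adj_mult[OF ab(1) sp(1)] multiplicative[OF ab(2) tq(2)])
  qed
  have T_inv: "T (inv\<^bsub>G\<^esub> g) x = adj p (\<pi> s x)" "T (inv\<^bsub>G\<^esub> h) x = adj q (\<pi> t x)"
    and T_gh: "T g x = adj s (\<pi> p x)" "T h x = adj t (\<pi> q x)" for x
    using sp tq by (simp_all add: quot_inv T)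
  have "T (inv\<^bsub>G\<^esub> g) (T g (T h x)) = T (inv\<^bsub>G\<^esub> g) (T (g \<otimes>\<^bsub>G\<^esub> h) x)" for x
  proof -
    have "T (inv\<^bsub>G\<^esub> g) (T g (T h x))
        = adj p (\<pi> s (adj s (\<pi> p (adj p (adj a (\<pi> b (\<pi> q x)))))))"
      by (simp add: T_inv T_gh flip: adj_t)
    \<comment> \<open>The range projection of \<open>p\<close> moves left past that of
      \<open>s\<close> and is absorbed by \<open>adj p\<close>.\<close>
    also have "\<dots> = adj p (\<pi> s (adj s (adj a (\<pi> b (\<pi> q x)))))"
      using sp by (subst range_projections_commute) (simp_all add: adj_cancel)
    finally show ?thesis by (simp add: T_inv gh)
  qed
  then show "T (inv\<^bsub>G\<^esub> g) \<circ> T g \<circ> T h = T (inv\<^bsub>G\<^esub> g) \<circ> T (g \<otimes>\<^bsub>G\<^esub> h)"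
    by (simp add: fun_eq_iff)
  have "T g (T h (T (inv\<^bsub>G\<^esub> h) x)) = T (g \<otimes>\<^bsub>G\<^esub> h) (T (inv\<^bsub>G\<^esub> h) x)" for x
  proof -
    have "T g (T h (T (inv\<^bsub>G\<^esub> h) x))
        = adj s (adj a (\<pi> b (\<pi> t (adj t (\<pi> q (adj q (\<pi> t x)))))))"
      by (simp add: T_inv T_gh flip: \<pi>_p)
    \<comment> \<open>The range projection of \<open>t\<close> moves right past that of
      \<open>q\<close> and is absorbed by \<open>\<pi> t\<close>.\<close>
    also have "\<dots> = adj s (adj a (\<pi> b (\<pi> q (adj q (\<pi> t x)))))"
      using tq by (subst range_projections_commute) (simp_all add: adj_cancel)
    finally show ?thesis by (simp add: T_inv gh)
  qed
  then show "T g \<circ> T h \<circ> T (inv\<^bsub>G\<^esub> h) = T (g \<otimes>\<^bsub>G\<^esub> h) \<circ> T (inv\<^bsub>G\<^esub> h)"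
    by (simp add: fun_eq_iff)
qed

end

section \<open>Contractivity of star homomorphisms\<close>

lemma norm_star: "norm (star x) = norm (x :: 'a::cstar_algebra)"
proof -
  have le: "norm x \<le> norm (star x)" for x :: 'a
  proof (cases "x = 0")
    case False
    have "norm x * norm x \<le> norm (star x) * norm x"
      using norm_mult_ineq[of "star x" x] by (simp add: cstar_identity power2_eq_square)
    then show ?thesis using False by simp
  qed simp
  show ?thesis using le[of x] le[of "star x"] by (simp add: star_star)
qed

lemma star_scaleR: "star (r *\<^sub>R x) = r *\<^sub>R star (x :: 'a::cstar_algebra)"
  by (simp add: scaleR_scaleC star_scaleC)

lemma bounded_linear_star: "bounded_linear (star :: 'a::cstar_algebra \<Rightarrow> 'a)"
  by (rule bounded_linear_intro[of _ 1]) (simp_all add: star_add star_scaleR norm_star)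

text \<open>Formally, $1 - c = \sqrt{1 - h^2}$, found as a fixed point of $c \mapsto (h^2 + c^2)/2$.\<close>

lemma selfadjoint_complement:
  fixes h :: "'a::cstar_algebra"
  assumes h: "star h = h" and less: "norm h < 1"
  obtains c where "star c = c" "c * h = h * c" "h * h + c * c = c + c"
proof -
  interpret star: bounded_linear "star :: 'a \<Rightarrow> 'a" by (rule bounded_linear_star)
  \<comment> \<open>The norm bound makes \<open>F\<close> map \<open>K\<close> to itself with
    Lipschitz constant \<open>norm h < 1\<close>. The other two conditions are closed, so the fixed
    point inherits them.\<close>
  define K where "K = {c. norm c \<le> norm h \<and> star c = c \<and> c * h = h * c}"
  define F where "F c = (1/2) *\<^sub>R (h * h + c * c)" for c
  have "closed K"
    unfolding K_def
    by (intro closed_Collect_conj closed_Collect_le closed_Collect_eq continuous_intros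
        star.continuous_on)
  then have "complete K" by (simp add: complete_eq_closed)
  moreover have "K \<noteq> {}"
    by (auto simp: K_def star.zero intro: exI[of _ 0])
  moreover have "F ` K \<subseteq> K"
  proof (intro image_subsetI)
    fix c assume c: "c \<in> K"
    have "norm (h * h + c * c) \<le> norm h * norm h + norm c * norm c"
      by (intro norm_triangle_le add_mono norm_mult_ineq)
    also have "\<dots> \<le> norm h * 1 + norm h * 1"
      using c less by (intro add_mono mult_mono) (auto simp: K_def)
    finally have "norm (F c) \<le> norm h" by (simp add: F_def)
    moreover have "star (F c) = F c"
      using c h by (simp add: F_def K_def star_scaleR star_add star_mult)
    moreover have "F c * h = h * F c"
    proof -
      have "c * c * h = h * (c * c)"
        using c by (simp add: K_def mult.assoc) (simp flip: mult.assoc)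
      then show ?thesis by (simp add: F_def distrib_left distrib_right mult.assoc)
    qed
    ultimately show "F c \<in> K" by (simp add: K_def)
  qed
  moreover have "dist (F c) (F d) \<le> norm h * dist c d" if "c \<in> K" "d \<in> K" for c d
  proof -
    have "F c - F d = (1/2) *\<^sub>R (c * (c - d) + (c - d) * d)"
      by (simp add: F_def algebra_simps)
    then have "norm (F c - F d) \<le> (norm (c * (c - d)) + norm ((c - d) * d)) / 2"
      by (simp add: norm_triangle_ineq)
    also have "\<dots> \<le> (norm h * norm (c - d) + norm (c - d) * norm h) / 2"
      using that
      by (intro divide_right_mono add_mono order_trans[OF norm_mult_ineq] mult_mono)
        (auto simp: K_def)
    finally show ?thesis by (simp add: dist_norm)
  qed
  ultimately have "\<exists>!c\<in>K. F c = c"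
    using less by (intro Banach_fix[of _ "norm h"]) auto
  then obtain c where c: "c \<in> K" "F c = c" by blast
  then have "2 *\<^sub>R F c = 2 *\<^sub>R c" by simp
  then have "h * h + c * c = c + c"
    by (simp add: F_def scaleR_2)
  then show ?thesis
    using c by (intro that[of c]) (simp_all add: K_def)
qed

text \<open>Here $k^2 + (1-d)^2 = 1$, so left multiplications by $k \pm i(1-d)$ are isometric.
  Working with left multiplications avoids adjoining a unit.\<close>

lemma norm_le_one_if_complement:
  fixes k :: "'a::cstar_algebra"
  assumes k: "star k = k" and d: "star d = d" and comm: "d * k = k * d"
    and compl: "k * k + d * d = d + d"
  shows "norm k \<le> 1"
proof -
  have uminus: "(- c) *\<^sub>C x = - (c *\<^sub>C x)" for c and x :: 'a
  proof -
    have "(- c) *\<^sub>C x + c *\<^sub>C x = 0 *\<^sub>C x" by (simp flip: scaleC_add_left)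
    also have "\<dots> = 0" using scaleR_scaleC[of 0 x] by simp
    finally show ?thesis by (simp add: eq_neg_iff_add_eq_0)
  qed
  \<comment> \<open>The vector is formally (k + c(1-d))k with a unitary left factor. Expanding
    \<open>star\<close> of it times itself should therefore give \<open>k * k\<close>.\<close>
  have isom: "norm (k * k + c *\<^sub>C (k - d * k)) = norm k" if c: "c = \<i> \<or> c = -\<i>" for c
  proof -
    define e where "e = k - d * k"
    have e': "star e = k - k * d"
    proof -
      interpret star: bounded_linear "star :: 'a \<Rightarrow> 'a" by (rule bounded_linear_star)
      show ?thesis by (simp add: e_def star.diff star_mult k d)
    qed
    have ee: "star e * e = k * k - (k * d * k + k * d * k) + k * (d * d) * k"
      unfolding e' unfolding e_def by (simp add: algebra_simps)
    have dd: "d * d = d + d - k * k"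
      using compl by (simp add: algebra_simps)
    \<comment> \<open>Formally k(1-d)^2 k = k(1-k^2)k.\<close>
    have ee': "star e * e + k * k * (k * k) = k * k"
      unfolding ee dd by (simp add: algebra_simps)
    \<comment> \<open>The mixed terms agree because \<open>d\<close> and \<open>k\<close> commute,
      and they cancel because \<open>cnj c = - c\<close>.\<close>
    have cross: "k * k * e = star e * (k * k)"
    proof -
      have "k * (k * (d * k)) = k * (d * (k * k))"
        by (metis comm mult.assoc)
      then show ?thesis unfolding e' unfolding e_def by (simp add: algebra_simps)
    qed
    have cc: "cnj c = - c" "cnj c * c = 1" using c by auto
    have "star (k * k + c *\<^sub>C e) * (k * k + c *\<^sub>C e)
       = k * k * (k * k) + c *\<^sub>C (k * k * e) + (cnj c *\<^sub>C (star e * (k * k))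
         + (cnj c * c) *\<^sub>C (star e * e))"
      by (simp add: star_add star_mult star_scaleC k distrib_left distrib_right
          mult_scaleC_left mult_scaleC_right scaleC_add_right scaleC_scaleC mult.commute add_ac)
    also have "\<dots> = k * k"
      unfolding cross cc(2) unfolding cc(1) by (simp add: uminus scaleC_one ee' add.commute)
    finally have "(norm (k * k + c *\<^sub>C e))\<^sup>2 = norm (star k * k)"
      by (simp add: k flip: cstar_identity)
    then show ?thesis
      by (simp add: cstar_identity e_def)
  qed
  \<comment> \<open>So \<open>k * k\<close> is the average of two elements of norm
    \<open>norm k\<close>, whence the square of \<open>norm k\<close> is at most
    \<open>norm k\<close>.\<close>
  have "2 *\<^sub>R (k * k) = (k * k + \<i> *\<^sub>C (k - d * k)) + (k * k + (- \<i>) *\<^sub>C (k - d * k))"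
    by (simp add: uminus scaleR_2)
  then have "norm (2 *\<^sub>R (k * k)) \<le> norm k + norm k"
    by (metis isom norm_triangle_ineq)
  then have "norm (star k * k) \<le> norm k"
    by (simp add: k)
  then have "norm k * norm k \<le> 1 * norm k"
    by (simp only: cstar_identity power2_eq_square mult_1)
  then show ?thesis
    by (cases "k = 0") (auto simp: mult_le_cancel_right)
qed

lemma star_hom_scaleR:
  "star_hom_on UNIV f \<Longrightarrow> f (r *\<^sub>R x) = r *\<^sub>R f x"
  by (simp add: star_hom_on_def scaleR_scaleC)

text \<open>For \<open>norm x < 1\<close>, the complement \<open>c\<close> of
  \<open>h = star x * x\<close> is carried to a complement \<open>f c\<close> of \<open>f h\<close>.
  This bounds \<open>norm (f h)\<close>, the square of \<open>norm (f x)\<close>, by 1; scaling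
  gives the rest.\<close>

lemma star_hom_contractive:
  fixes f :: "'a::cstar_algebra \<Rightarrow> 'b::cstar_algebra"
  assumes f: "star_hom_on UNIV f"
  shows "norm (f x) \<le> norm x"
proof -
  have add: "f (x + y) = f x + f y" and mult: "f (x * y) = f x * f y"
    and st: "f (star x) = star (f x)" for x y
    using f by (auto simp: star_hom_on_def)
  have unit_ball: "norm (f x) \<le> 1" if "norm x < 1" for x
  proof -
    define h where "h = star x * x"
    have h: "star h = h" by (simp add: h_def star_mult star_star)
    have "norm h < 1"
      using that by (simp add: h_def cstar_identity power_less_one_iff)
    then obtain c where "star c = c" "c * h = h * c" "h * h + c * c = c + c"
      using selfadjoint_complement[OF h] by blast
    then have "norm (f h) \<le> 1"
      by (intro norm_le_one_if_complement[of _ "f c"]) (simp_all flip: st mult add add: h)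
    then have "(norm (f x))\<^sup>2 \<le> 1"
      by (simp add: h_def mult st cstar_identity)
    then show ?thesis by (simp add: power_le_one_iff)
  qed
  show ?thesis
  proof (rule field_le_epsilon)
    fix e :: real assume "0 < e"
    \<comment> \<open>Adding \<open>e\<close> puts \<open>x\<close> divided by \<open>r\<close>
      strictly inside the unit ball and keeps \<open>r\<close> positive when
      \<open>x = 0\<close>.\<close>
    define r where "r = norm x + e"
    have r: "r > 0" using \<open>0 < e\<close> by (simp add: r_def add_nonneg_pos)
    have "norm ((1/r) *\<^sub>R x) < 1"
      using r \<open>0 < e\<close> by (simp add: r_def)
    then have "norm ((1/r) *\<^sub>R f x) \<le> 1"
      using unit_ball star_hom_scaleR[OF f] by metis
    then show "norm (f x) \<le> norm x + e"
      using r by (simp add: field_simps) (simp add: r_def)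
  qed
qed

lemma closed_star_ideal_vimage:
  assumes f: "star_hom_on UNIV f" and I: "closed_star_ideal I"
  shows "closed_star_ideal (f -` I)"
proof -
  have f0: "f 0 = 0"
    using star_hom_scaleR[OF f, of 0 0] by simp
  have "bounded_linear f"
    using f star_hom_contractive[OF f] star_hom_scaleR[OF f]
    by (intro bounded_linear_intro[of _ 1]) (auto simp: star_hom_on_def)
  then have "closed (f -` I)"
    using I by (intro continuous_closed_vimage)
      (auto simp: closed_star_ideal_def linear_continuous_at)
  then show ?thesis
    using f I f0 by (auto simp: closed_star_ideal_def star_hom_on_def)
qed

section \<open>The partial action induced on a C*-algebra\<close>

locale induced_ideal_map = induced_map S G \<iota> UNIV \<alpha> \<theta> + injective_action_ideal_images S \<alpha>
  for S (structure) and G (structure) and \<iota> and \<alpha> :: "_ \<Rightarrow> 'x::cstar_algebra \<Rightarrow> 'x" and \<theta>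
begin

lemma cstar_partial_action: "cstar_partial_action G D \<theta>"
proof -
  interpret partial_action G UNIV D \<theta> by (rule partial_action)
  show ?thesis
  proof unfold_locales
    fix g assume "g \<in> carrier G"
    then obtain s p where sp: "s \<in> carrier S" "p \<in> carrier S" "g = quot s p"
      using quotE by metis
    have "D g = \<alpha> s -` range (\<alpha> p)"
      using sp by (auto simp: quot_domain)
    then show "closed_star_ideal (D g)"
      using sp star_hom ideal_image closed_star_ideal_vimage by metis
    have D_inv: "D (inv\<^bsub>G\<^esub> g) = \<alpha> p -` range (\<alpha> s)"
      using sp by (auto simp: quot_inv quot_domain)
    have ideal: "closed_star_ideal (D (inv\<^bsub>G\<^esub> g))"
      unfolding D_inv using sp star_hom ideal_image closed_star_ideal_vimage by metis
    \<comment> \<open>The value of \<open>\<theta> g\<close> at \<open>x\<close> is the only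
      solution of this equation. Each homomorphism identity for \<open>\<theta> g\<close> can
      therefore be verified after applying \<open>\<alpha> s\<close>, where it follows from those
      for \<open>\<alpha> p\<close> and \<open>\<alpha> s\<close>.\<close>
    have map: "(the \<circ> \<theta> g) x = y" if "\<alpha> p x = \<alpha> s y" for x y
      using that sp quot_map_eq_Some by (metis UNIV_I comp_apply option.sel)
    have spec: "\<alpha> p x = \<alpha> s ((the \<circ> \<theta> g) x)" if "x \<in> D (inv\<^bsub>G\<^esub> g)" for x
      using that map by (force simp: D_inv)
    note hom = star_hom[OF sp(1), unfolded star_hom_on_def] star_hom[OF sp(2), unfolded star_hom_on_def]
    show "star_hom_on (D (inv\<^bsub>G\<^esub> g)) (the \<circ> \<theta> g)"
      unfolding star_hom_on_def
      using hom spec by (intro conjI ballI allI map) simp_all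
  qed
qed

end

section \<open>The three induced structures together\<close>

theorem corollary8p9:
  fixes S :: "('s, 'm) monoid_scheme" and G :: "('g, 'n) monoid_scheme" and \<iota> :: "'s \<Rightarrow> 'g"
  assumes "left_quotient_group S G \<iota>"
  shows
    "(\<forall>\<pi> :: 's \<Rightarrow> 'h::chilbert_space \<Rightarrow> 'h. isometric_inverse_representation S \<pi> \<longrightarrow>
        (\<exists>T. partial_representation G T \<and>
             (\<forall>s\<in>carrier S. \<forall>p\<in>carrier S.
                T (inv\<^bsub>G\<^esub> (\<iota> s) \<otimes>\<^bsub>G\<^esub> \<iota> p) = cadjoint (\<pi> s) \<circ> \<pi> p)))
     \<and> (\<forall>(X :: 'x set) \<alpha>. injective_action S X \<alpha> \<longrightarrow>
        (\<exists>D \<theta>. partial_action G X D \<theta> \<and>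
             (\<forall>s\<in>carrier S. \<forall>p\<in>carrier S.
                \<theta> (inv\<^bsub>G\<^esub> (\<iota> s) \<otimes>\<^bsub>G\<^esub> \<iota> p) = partial_inverse X (\<alpha> s) \<circ>\<^sub>m as_partial X (\<alpha> p))))
     \<and> (\<forall>\<alpha> :: 's \<Rightarrow> 'a::cstar_algebra \<Rightarrow> 'a. injective_action_ideal_images S \<alpha> \<longrightarrow>
        (\<exists>D \<theta>. cstar_partial_action G D \<theta> \<and>
             (\<forall>s\<in>carrier S. \<forall>p\<in>carrier S.
                \<theta> (inv\<^bsub>G\<^esub> (\<iota> s) \<otimes>\<^bsub>G\<^esub> \<iota> p) = partial_inverse UNIV (\<alpha> s) \<circ>\<^sub>m as_partial UNIV (\<alpha> p))))"
proof (intro conjI allI impI)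
  interpret left_quotient_group S G \<iota> by (rule assms)
  {
    fix \<pi> :: "'s \<Rightarrow> 'h \<Rightarrow> 'h"
    assume "isometric_inverse_representation S \<pi>"
    then interpret quotient_representation S G \<iota> \<pi>
      by (intro quotient_representation.intro assms)
    show "\<exists>T. partial_representation G T \<and>
        (\<forall>s\<in>carrier S. \<forall>p\<in>carrier S.
          T (inv\<^bsub>G\<^esub> (\<iota> s) \<otimes>\<^bsub>G\<^esub> \<iota> p) = cadjoint (\<pi> s) \<circ> \<pi> p)"
      using quotient_operators partial_representation unfolding quot_def by metis
  }
  {
    fix X :: "'x set" and \<alpha>
    assume "injective_action S X \<alpha>"
    then interpret quotient_action S G \<iota> X \<alpha>
      by (intro quotient_action.intro assms)
    obtain \<theta> where "induced_map S G \<iota> X \<alpha> \<theta>"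
      using quotient_map induced_map.intro induced_map_axioms.intro quotient_action_axioms by metis
    then interpret induced_map S G \<iota> X \<alpha> \<theta> .
    show "\<exists>D \<theta>. partial_action G X D \<theta> \<and>
        (\<forall>s\<in>carrier S. \<forall>p\<in>carrier S.
          \<theta> (inv\<^bsub>G\<^esub> (\<iota> s) \<otimes>\<^bsub>G\<^esub> \<iota> p) = partial_inverse X (\<alpha> s) \<circ>\<^sub>m as_partial X (\<alpha> p))"
      using partial_action quot_map unfolding quot_def by blast
  }
  {
    fix \<alpha> :: "'s \<Rightarrow> 'a \<Rightarrow> 'a"
    assume ideal: "injective_action_ideal_images S \<alpha>"
    then interpret quotient_action S G \<iota> UNIV \<alpha>
      by (intro quotient_action.intro assms injective_action_ideal_images.axioms(1))
    obtain \<theta> where "induced_map S G \<iota> UNIV \<alpha> \<theta>"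
      using quotient_map induced_map.intro induced_map_axioms.intro quotient_action_axioms by metis
    then interpret induced_ideal_map S G \<iota> \<alpha> \<theta>
      using ideal by (intro induced_ideal_map.intro)
    show "\<exists>D \<theta>. cstar_partial_action G D \<theta> \<and>
        (\<forall>s\<in>carrier S. \<forall>p\<in>carrier S.
          \<theta> (inv\<^bsub>G\<^esub> (\<iota> s) \<otimes>\<^bsub>G\<^esub> \<iota> p) = partial_inverse UNIV (\<alpha> s) \<circ>\<^sub>m as_partial UNIV (\<alpha> p))"
      using cstar_partial_action quot_map unfolding quot_def by blast
  }
qed

end
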